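(* Let $K$ be a field of characteristic zero, let $n\ge 2$, let $P_{n+1}=K[x_1,\dots,x_{n+1}]$ be the polynomial algebra, and let $\sigma$ be the $K$-algebra automorphism of $P_{n+1}$ given by $\sigma(x_1)=x_1$ and $\sigma(x_i)=x_i+x_{i-1}$ for $2\le i\le n+1$. Set $m:=[\frac n2]$. For $1\le k\le m$ let $$p_k=x_{k+1}^2+\sum_{i=1}^{k-1}\sum_{j=k}^{2k-i}\lambda_{i,j}^k x_{i+1}x_{j+1}-x_1\sum_{i=k}^{2k}\mu_i^kx_{i+1},$$ where $$\lambda_{i,j}^k=(-1)^{k-i}\left\{\binom{k-i}{j-k}+\binom{k-i-1}{j-k-1}\right\},\qquad \mu_i^k=(-1)^{k-1}\left\{\binom{k}{i-k}+\binom{k-1}{i-k-1}\right\}.$$ Then $x_1^2,p_1,\dots,p_m$ is a $K$-basis of the vector space of quadratic invariants of $\sigma$.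
   Context: The space of quadratic invariants is the space of homogeneous polynomials $f\in P_{n+1}$ of degree $2$ (together with $0$) such that $\sigma(f)=f$. $[r]$ is the floor of $r$. Convention: $\binom{a}{b}=0$ for integers $a,b$ not satisfying $0\le b\le a$. *)

theory Defs
  imports Complex_Main "HOL-Library.Poly_Mapping"
begin

text \<open>
  Polynomials are finitely supported functions from monomials to coefficients, where a monomial
  is a finitely supported exponent vector; the variables are indexed by all natural numbers.
  The algebra in the variables with indices \<open>1, \<dots>, N\<close> is the carrier set \<open>poly_alg N\<close> below.
\<close>

type_synonym 'a mpoly = "(nat \<Rightarrow>\<^sub>0 nat) \<Rightarrow>\<^sub>0 'a"

definition Const :: "'a::zero \<Rightarrow> 'a mpoly" where
  "Const c = Poly_Mapping.single 0 c"

definition Var :: "nat \<Rightarrow> 'a::zero_neq_one mpoly" where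
  "Var i = Poly_Mapping.single (Poly_Mapping.single i 1) 1"

definition poly_alg :: "nat \<Rightarrow> 'a::zero mpoly set" where
  "poly_alg N = {f. \<forall>m \<in> Poly_Mapping.keys f. Poly_Mapping.keys m \<subseteq> {1..N}}"

definition monom_degree :: "(nat \<Rightarrow>\<^sub>0 nat) \<Rightarrow> nat" where
  "monom_degree m = (\<Sum>i \<in> Poly_Mapping.keys m. Poly_Mapping.lookup m i)"

text \<open>The zero polynomial is homogeneous of every degree.\<close>

definition homogeneous :: "nat \<Rightarrow> 'a::zero mpoly \<Rightarrow> bool" where
  "homogeneous d f \<longleftrightarrow> (\<forall>m \<in> Poly_Mapping.keys f. monom_degree m = d)"

definition scale :: "'a::field \<Rightarrow> 'a mpoly \<Rightarrow> 'a mpoly" where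
  "scale c f = Const c * f"

global_interpretation mpoly: vector_space "scale :: 'a::field \<Rightarrow> 'a mpoly \<Rightarrow> 'a mpoly"
  by unfold_locales
    (simp_all add: scale_def Const_def algebra_simps single_add mult_single flip: mult.assoc)


subsection \<open>Substitution homomorphisms and the automorphism \<open>\<sigma>\<close>\<close>

definition monom_subst :: "(nat \<Rightarrow> 'a::comm_ring_1 mpoly) \<Rightarrow> (nat \<Rightarrow>\<^sub>0 nat) \<Rightarrow> 'a mpoly" where
  "monom_subst s m = (\<Prod>i \<in> Poly_Mapping.keys m. s i ^ Poly_Mapping.lookup m i)"

definition subst :: "(nat \<Rightarrow> 'a::comm_ring_1 mpoly) \<Rightarrow> 'a mpoly \<Rightarrow> 'a mpoly" where
  "subst s f = (\<Sum>m \<in> Poly_Mapping.keys f. Const (Poly_Mapping.lookup f m) * monom_subst s m)"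

text \<open>
  The formula for \<open>\<sigma>\<close> does not depend on the number of variables, so one map serves all
  algebras \<open>poly_alg N\<close>; \<open>sigma_aut_bij_betw\<close> below shows that it restricts to a bijection of each.
\<close>

definition sigma_aut :: "'a::comm_ring_1 mpoly \<Rightarrow> 'a mpoly" where
  "sigma_aut = subst (\<lambda>i. if 2 \<le> i then Var i + Var (i - 1) else Var i)"

definition quadratic_invariants :: "nat \<Rightarrow> 'a::comm_ring_1 mpoly set" where
  "quadratic_invariants n = {f \<in> poly_alg (n + 1). homogeneous 2 f \<and> sigma_aut f = f}"


subsection \<open>The polynomials \<open>p\<^sub>k\<close>\<close>

text \<open>
  Binomial coefficients of integers that vanish unless \<open>0 \<le> b \<le> a\<close>. Integer arguments are
  needed since lower arguments such as \<open>j - k - 1\<close> take the value \<open>-1\<close>.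
\<close>

definition ibinom :: "int \<Rightarrow> int \<Rightarrow> nat" where
  "ibinom a b = (if 0 \<le> b \<and> b \<le> a then nat a choose nat b else 0)"

text \<open>
  In the signs, the natural number subtractions \<open>k - i\<close> and \<open>k - 1\<close> do not truncate for the
  indices that occur in \<open>p_quad k\<close>, \<open>k \<ge> 1\<close>.
\<close>

definition lam :: "nat \<Rightarrow> nat \<Rightarrow> nat \<Rightarrow> 'a::comm_ring_1" where
  "lam k i j = (- 1) ^ (k - i) *
     of_nat (ibinom (int k - int i) (int j - int k) + ibinom (int k - int i - 1) (int j - int k - 1))"

definition mu :: "nat \<Rightarrow> nat \<Rightarrow> 'a::comm_ring_1" where
  "mu k i = (- 1) ^ (k - 1) *
     of_nat (ibinom (int k) (int i - int k) + ibinom (int k - 1) (int i - int k - 1))"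

definition p_quad :: "nat \<Rightarrow> 'a::comm_ring_1 mpoly" where
  "p_quad k = Var (k + 1) ^ 2
     + (\<Sum>i = 1..k - 1. \<Sum>j = k..2 * k - i. Const (lam k i j) * Var (i + 1) * Var (j + 1))
     - Var 1 * (\<Sum>i = k..2 * k. Const (mu k i) * Var (i + 1))"


subsection \<open>\<open>\<sigma>\<close> is a \<open>K\<close>-algebra automorphism\<close>

lemma Const_0: "Const 0 = 0" and Const_1: "Const 1 = 1"
  and Const_add: "Const (a + b) = Const a + Const b"
  and Const_mult: "Const (a * b) = Const a * Const b" for a b :: "'a::comm_ring_1"
  by (simp_all add: Const_def single_add mult_single)

lemma sum_monomials:
  "f = (\<Sum>m \<in> Poly_Mapping.keys f. Poly_Mapping.single m (Poly_Mapping.lookup f m))"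
  by (rule poly_mapping_eqI) (simp add: lookup_sum lookup_single when_def in_keys_iff)

lemma monom_subst_superset:
  assumes "finite A" "Poly_Mapping.keys m \<subseteq> A"
  shows "monom_subst s m = (\<Prod>i \<in> A. s i ^ Poly_Mapping.lookup m i)"
  unfolding monom_subst_def
  by (rule prod.mono_neutral_left) (use assms in \<open>auto simp: in_keys_iff\<close>)

lemma monom_subst_add: "monom_subst s (a + b) = monom_subst s a * monom_subst s b"
proof -
  let ?A = "Poly_Mapping.keys a \<union> Poly_Mapping.keys b"
  have fin: "finite ?A" by simp
  show ?thesis
    using monom_subst_superset[OF fin keys_add, of s]
      monom_subst_superset[OF fin, of a s] monom_subst_superset[OF fin, of b s]
    by (simp add: lookup_add power_add prod.distrib)
qed

lemma subst_single: "subst s (Poly_Mapping.single m c) = Const c * monom_subst s m"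
  by (simp add: subst_def Const_0)

lemma subst_add: "subst s (f + g) = subst s f + subst s g"
  unfolding subst_def
  by (rule setsum_keys_plus_distrib) (simp_all add: Const_0 Const_add algebra_simps)

lemma subst_0: "subst s 0 = 0"
  by (simp add: subst_def)

lemma subst_sum: "subst s (sum F A) = (\<Sum>x \<in> A. subst s (F x))"
  by (induction A rule: infinite_finite_induct) (simp_all add: subst_0 subst_add)

lemma subst_Const: "subst s (Const c) = Const c"
  by (simp add: Const_def[of c] subst_single) (simp add: Const_def monom_subst_def)

lemma subst_Var: "subst s (Var i) = s i"
  by (simp add: Var_def subst_single Const_1 monom_subst_def)

lemma subst_mult: "subst s (f * g) = subst s f * subst s g"
proof -
  have single: "subst s (Poly_Mapping.single a c * Poly_Mapping.single b d) =
      subst s (Poly_Mapping.single a c) * subst s (Poly_Mapping.single b d)" for a b c d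
    by (simp add: mult_single subst_single Const_mult monom_subst_add algebra_simps)
  show ?thesis
    by (subst (1 2) sum_monomials[of f], subst (1 2) sum_monomials[of g])
      (simp only: sum_product subst_sum single)
qed

lemma subst_1: "subst s 1 = 1"
  using subst_Const[of s 1] by (simp add: Const_1)

lemma subst_uminus: "subst s (- f) = - subst s f"
  using subst_add[of s f "- f"] by (simp add: subst_0 eq_neg_iff_add_eq_0 add.commute)

lemma subst_power: "subst s (f ^ k) = subst s f ^ k"
  by (induction k) (simp_all add: subst_1 subst_mult)

lemma subst_prod: "subst s (prod F A) = (\<Prod>x \<in> A. subst s (F x))"
  by (induction A rule: infinite_finite_induct) (simp_all add: subst_1 subst_mult)

lemma subst_subst: "subst s (subst t f) = subst (\<lambda>i. subst s (t i)) f"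
proof -
  have "subst s (monom_subst t m) = monom_subst (\<lambda>i. subst s (t i)) m" for m
    by (simp add: monom_subst_def subst_prod subst_power)
  then show ?thesis
    by (simp add: subst_def[of t] subst_def[of "\<lambda>i. subst s (t i)"] subst_sum subst_mult subst_Const)
qed

lemma Var_power: "Var i ^ k = Poly_Mapping.single (Poly_Mapping.single i k) 1"
  by (induction k) (simp_all add: Var_def mult_single flip: single_add)

lemma subst_id: "subst Var f = f"
proof -
  have prod_single: "(\<Prod>i\<in>A. Poly_Mapping.single (F i) (1::'a)) = Poly_Mapping.single (sum F A) 1"
    for F :: "nat \<Rightarrow> nat \<Rightarrow>\<^sub>0 nat" and A
    by (induction A rule: infinite_finite_induct) (simp_all add: mult_single)
  have "monom_subst Var m = Poly_Mapping.single m (1::'a)" for m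
    by (simp add: monom_subst_def Var_power prod_single flip: sum_monomials)
  then show ?thesis
    by (simp add: subst_def Const_def mult_single flip: sum_monomials)
qed

lemma poly_alg_Const: "Const c \<in> poly_alg N"
  by (simp add: poly_alg_def Const_def)

lemma poly_alg_1: "(1 :: 'a::comm_ring_1 mpoly) \<in> poly_alg N"
  using poly_alg_Const[of "1::'a" N] by (simp add: Const_1)

lemma poly_alg_0: "0 \<in> poly_alg N"
  by (simp add: poly_alg_def)

lemma poly_alg_Var: "i \<in> {1..N} \<Longrightarrow> Var i \<in> poly_alg N"
  by (simp add: poly_alg_def Var_def)

lemma poly_alg_add: "f \<in> poly_alg N \<Longrightarrow> g \<in> poly_alg N \<Longrightarrow> f + g \<in> poly_alg N"
  unfolding poly_alg_def using keys_add[of f g] by blast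

lemma poly_alg_diff: "f \<in> poly_alg N \<Longrightarrow> g \<in> poly_alg N \<Longrightarrow> f - g \<in> poly_alg N"
  for f g :: "'a::comm_ring_1 mpoly"
  using poly_alg_add[of f N "- g"] by (simp add: poly_alg_def)

lemma poly_alg_mult:
  fixes f g :: "'a::comm_ring_1 mpoly"
  assumes "f \<in> poly_alg N" "g \<in> poly_alg N"
  shows "f * g \<in> poly_alg N"
proof -
  have "Poly_Mapping.keys m \<subseteq> {1..N}" if "m \<in> Poly_Mapping.keys (f * g)" for m
  proof -
    obtain a b where "m = a + b" "a \<in> Poly_Mapping.keys f" "b \<in> Poly_Mapping.keys g"
      using subsetD[OF keys_mult \<open>m \<in> Poly_Mapping.keys (f * g)\<close>] by auto
    then show ?thesis
      using assms keys_add[of a b] unfolding poly_alg_def by blast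
  qed
  then show ?thesis by (simp add: poly_alg_def)
qed

lemma poly_alg_power: "f \<in> poly_alg N \<Longrightarrow> f ^ k \<in> poly_alg N" for f :: "'a::comm_ring_1 mpoly"
  by (induction k) (simp_all add: poly_alg_1 poly_alg_mult)

lemma poly_alg_prod: "(\<And>x. x \<in> A \<Longrightarrow> F x \<in> poly_alg N) \<Longrightarrow> prod F A \<in> poly_alg N"
  for F :: "_ \<Rightarrow> 'a::comm_ring_1 mpoly"
  by (induction A rule: infinite_finite_induct) (simp_all add: poly_alg_1 poly_alg_mult)

lemma poly_alg_sum: "(\<And>x. x \<in> A \<Longrightarrow> F x \<in> poly_alg N) \<Longrightarrow> sum F A \<in> poly_alg N"
  for F :: "_ \<Rightarrow> 'a::comm_ring_1 mpoly"
  by (induction A rule: infinite_finite_induct) (simp_all add: poly_alg_0 poly_alg_add)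

lemma poly_alg_subst:
  assumes "f \<in> poly_alg N" "\<And>i. i \<in> {1..N} \<Longrightarrow> s i \<in> poly_alg N"
  shows "subst s f \<in> poly_alg N"
  unfolding subst_def monom_subst_def
  by (intro poly_alg_sum poly_alg_mult poly_alg_Const poly_alg_prod poly_alg_power assms(2))
    (use assms(1) in \<open>unfold poly_alg_def, blast\<close>)

lemma sigma_aut_add: "sigma_aut (f + g) = sigma_aut f + sigma_aut g"
  by (simp add: sigma_aut_def subst_add)

lemma sigma_aut_mult: "sigma_aut (f * g) = sigma_aut f * sigma_aut g"
  by (simp add: sigma_aut_def subst_mult)

lemma sigma_aut_Const: "sigma_aut (Const c) = Const c"
  by (simp add: sigma_aut_def subst_Const)

lemma sigma_aut_scale: "sigma_aut (scale c f) = scale c (sigma_aut f)"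
  by (simp add: scale_def sigma_aut_mult sigma_aut_Const)

lemma sigma_aut_Var: "sigma_aut (Var i) = (if 2 \<le> i then Var i + Var (i - 1) else Var i)"
  by (simp add: sigma_aut_def subst_Var)

fun sigma_inv_Var :: "nat \<Rightarrow> 'a::comm_ring_1 mpoly" where
  "sigma_inv_Var i = (if 2 \<le> i then Var i - sigma_inv_Var (i - 1) else Var i)"

declare sigma_inv_Var.simps [simp del]

lemma sigma_aut_bij_betw: "bij_betw (sigma_aut :: 'a::comm_ring_1 mpoly \<Rightarrow> _) (poly_alg N) (poly_alg N)"
proof (rule bij_betw_byWitness[where f' = "subst sigma_inv_Var"])
  have "subst sigma_inv_Var (if 2 \<le> i then Var i + Var (i - 1) else Var i) = (Var i :: 'a mpoly)" for i
    by (simp add: subst_add subst_Var sigma_inv_Var.simps[of i])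
  then show "\<forall>f \<in> poly_alg N. subst sigma_inv_Var (sigma_aut f) = (f :: 'a mpoly)"
    by (simp add: sigma_aut_def subst_subst subst_id)
  have "sigma_aut (sigma_inv_Var i) = (Var i :: 'a mpoly)" for i
  proof (induction i rule: less_induct)
    case (less i)
    have diff: "sigma_aut (f - g) = sigma_aut f - sigma_aut g" for f g :: "'a mpoly"
      using subst_add[of _ f "- g"] by (simp add: sigma_aut_def subst_uminus)
    show ?case
      using less[of "i - 1"] by (subst sigma_inv_Var.simps) (auto simp: diff sigma_aut_Var)
  qed
  then show "\<forall>f \<in> poly_alg N. sigma_aut (subst sigma_inv_Var f) = (f :: 'a mpoly)"
    by (simp add: sigma_aut_def subst_subst subst_id)
  show "sigma_aut ` poly_alg N \<subseteq> (poly_alg N :: 'a mpoly set)"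
  proof (rule image_subsetI, unfold sigma_aut_def, rule poly_alg_subst)
    show "(if 2 \<le> i then Var i + Var (i - 1) else Var i) \<in> (poly_alg N :: 'a mpoly set)"
      if "i \<in> {1..N}" for i
    proof -
      have "i - 1 \<in> {1..N}" if "2 \<le> i" using \<open>i \<in> {1..N}\<close> that by auto
      then show ?thesis
        using that by (simp add: poly_alg_add poly_alg_Var del: atLeastAtMost_iff)
    qed
  qed
  have "(sigma_inv_Var i :: 'a mpoly) \<in> poly_alg N" if "i \<in> {1..N}" for i
    using that
    by (induction i rule: less_induct) (subst sigma_inv_Var.simps, auto intro!: poly_alg_diff poly_alg_Var)
  then show "subst sigma_inv_Var ` poly_alg N \<subseteq> (poly_alg N :: 'a mpoly set)"
    by (auto intro!: poly_alg_subst)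
qed

end

theory Submission
  imports Defs
begin

text \<open>
  Write \<open>y\<^sub>i = x\<^sub>i\<^sub>+\<^sub>1\<close> and \<open>u\<^sub>d(k) = (1 + T)\<^sup>d\<^sup>-\<^sup>1 (1 + 2T) y\<^sub>k\<close> for \<open>d \<ge> 1\<close> and \<open>u\<^sub>0(k) = y\<^sub>k\<close>, where
  \<open>T\<close> is the shift \<open>y\<^sub>i \<mapsto> y\<^sub>i\<^sub>+\<^sub>1\<close>. Then \<open>p\<^sub>k\<close> is the alternating sum of the \<open>y\<^sub>k\<^sub>-\<^sub>d u\<^sub>d(k)\<close> over
  \<open>0 \<le> d \<le> k\<close>, and \<open>\<sigma> u\<^sub>d(k) = u\<^sub>d(k) + u\<^sub>d(k - 1) = u\<^sub>d\<^sub>+\<^sub>1(k - 1)\<close> for \<open>d \<ge> 1\<close> makes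
  \<open>\<sigma> p\<^sub>k - p\<^sub>k\<close> telescope to \<open>0\<close>.

  The only square \<open>y\<^sub>i\<^sup>2\<close> occurring in \<open>p\<^sub>k\<close> is \<open>y\<^sub>k\<^sup>2\<close>, with coefficient \<open>1\<close>; hence it suffices that an
  invariant without the squares \<open>y\<^sub>i\<^sup>2\<close>, \<open>i \<le> m\<close>, vanishes. The symmetric matrix \<open>b\<close> of an
  invariant satisfies \<open>b\<^sub>i\<^sub>+\<^sub>1\<^sub>,\<^sub>j + b\<^sub>i\<^sub>,\<^sub>j\<^sub>+\<^sub>1 + b\<^sub>i\<^sub>+\<^sub>1\<^sub>,\<^sub>j\<^sub>+\<^sub>1 = 0\<close>, so on the highest antidiagonal
  \<open>i + j = s\<close> where \<open>b\<close> is nonzero its entries agree up to alternating signs. One of them is zero: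
  \<open>b\<^sub>0\<^sub>,\<^sub>s\<close> if \<open>s > n\<close>, the middle one if \<open>s \<le> n\<close> is even, and \<open>b\<^sub>0\<^sub>,\<^sub>s = - b\<^sub>s\<^sub>,\<^sub>0\<close> by symmetry if \<open>s\<close> is odd.
\<close>

subsection \<open>Invariance of the polynomials \<open>p\<^sub>k\<close>\<close>

lemma Const_of_nat: "Const (of_nat c :: 'a::comm_ring_1) = of_nat c"
  by (induction c) (simp_all add: Const_0 Const_1 Const_add)

lemma Const_uminus: "Const (- c :: 'a::comm_ring_1) = - Const c"
  by (simp add: Const_def single_uminus)

lemma Const_minus_one_power: "Const ((- 1) ^ d :: 'a::comm_ring_1) = (- 1) ^ d"
  by (induction d) (simp_all add: Const_1 Const_uminus)

lemma sigma_aut_uminus: "sigma_aut (- f) = - sigma_aut f"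
  by (simp add: sigma_aut_def subst_uminus)

lemma sigma_aut_diff: "sigma_aut (f - g) = sigma_aut f - sigma_aut g"
  using sigma_aut_add[of f "- g"] by (simp add: sigma_aut_uminus)

lemma sigma_aut_power: "sigma_aut (f ^ k) = sigma_aut f ^ k"
  by (simp add: sigma_aut_def subst_power)

lemma sigma_aut_sum: "sigma_aut (sum F A) = (\<Sum>x \<in> A. sigma_aut (F x))"
  by (simp add: sigma_aut_def subst_sum)

lemma sigma_aut_1: "sigma_aut 1 = 1"
  by (simp add: sigma_aut_def subst_1)

lemma sigma_aut_2: "sigma_aut 2 = 2"
  using sigma_aut_add[of 1 1] by (simp add: sigma_aut_1)

text \<open>This is \<open>u_d(k)\<close>, with \<open>y_k\<close> encoded as
  \<open>Var (Suc k)\<close>. The step from d = 0 to 1 multiplies by 1 + 2T and every later one by 1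
  + T, hence two base cases.\<close>

fun row_form :: "nat \<Rightarrow> nat \<Rightarrow> 'a::comm_ring_1 mpoly" where
  "row_form 0 k = Var (Suc k)"
| "row_form (Suc 0) k = Var (Suc k) + 2 * Var (Suc (Suc k))"
| "row_form (Suc (Suc d)) k = row_form (Suc d) k + row_form (Suc d) (Suc k)"

text \<open>Coefficient of T^e in (1 + T)^d + T (1 + T)^(d-1) = (1 + T)^(d-1) (1 + 2T) for d \<ge>
  1; for d = 0 the second summand vanishes and the constant 1 remains.\<close>

definition row_coeff :: "nat \<Rightarrow> nat \<Rightarrow> nat" where
  "row_coeff d e = ibinom (int d) (int e) + ibinom (int d - 1) (int e - 1)"

lemma row_coeff_eq:
  "row_coeff (Suc d) 0 = 1"
  "row_coeff (Suc d) (Suc e) = (Suc d choose Suc e) + (d choose e)"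
  by (auto simp: row_coeff_def ibinom_def binomial_eq_0 simp flip: Suc_nat_eq_nat_zadd1)

text \<open>Multiplication of the generating function by 1 + T; it cannot start at row 0, where the
  factor is 1 + 2T.\<close>

lemma row_coeff_Pascal:
  "row_coeff (Suc (Suc d)) (Suc e) = row_coeff (Suc d) e + row_coeff (Suc d) (Suc e)"
  by (cases e) (simp_all add: row_coeff_eq)

lemma row_form_eq:
  "row_form d k = (\<Sum>e\<le>d. of_nat (row_coeff d e) * Var (Suc (k + e)))"
proof (induction d k rule: row_form.induct)
  case (3 d k)
  let ?c = "\<lambda>d e. of_nat (row_coeff d e) :: 'a mpoly"
  have top: "?c (Suc d) (Suc (Suc d)) = 0"
    by (simp add: row_coeff_eq binomial_eq_0)
  have "(\<Sum>e\<le>Suc (Suc d). ?c (Suc (Suc d)) e * Var (Suc (k + e)))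
      = ?c (Suc d) 0 * Var (Suc k)
        + (\<Sum>e\<le>Suc d. (?c (Suc d) e + ?c (Suc d) (Suc e)) * Var (Suc (k + Suc e)))"
    by (subst sum.atMost_Suc_shift) (simp add: row_coeff_Pascal, simp add: row_coeff_eq)
  also have "\<dots> = (?c (Suc d) 0 * Var (Suc k)
        + (\<Sum>e\<le>Suc d. ?c (Suc d) (Suc e) * Var (Suc (k + Suc e)))) + row_form (Suc d) (Suc k)"
    unfolding "3.IH"(2) distrib_right sum.distrib by (simp add: algebra_simps)
  also have "?c (Suc d) 0 * Var (Suc k)
        + (\<Sum>e\<le>Suc d. ?c (Suc d) (Suc e) * Var (Suc (k + Suc e)))
      = (\<Sum>e\<le>Suc (Suc d). ?c (Suc d) e * Var (Suc (k + e)))"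
    by (subst sum.atMost_Suc_shift) simp
  also have "\<dots> = row_form (Suc d) k"
    using top unfolding "3.IH"(1) by simp
  finally show ?case by simp
qed (simp_all add: row_coeff_eq, simp_all add: row_coeff_def ibinom_def)

text \<open>Where \<sigma> adds the preceding variable it commutes with T; the index
  \<open>Suc k\<close> keeps the fixed variable y_0 = x_1 out of the form.\<close>

lemma sigma_aut_row_form: "sigma_aut (row_form d (Suc k)) = row_form d (Suc k) + row_form d k"
proof (induction d "Suc k" arbitrary: k rule: row_form.induct)
  case (2 k)
  show ?case
    by (simp add: sigma_aut_add sigma_aut_mult sigma_aut_Var sigma_aut_2 algebra_simps)
qed (simp_all add: sigma_aut_add sigma_aut_Var)

text \<open>Terms are grouped by d = k - i: d = 0 is the square, 0 < d < k the \<lambda>-sum, d = k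
  the \<mu>-sum.\<close>

lemma p_quad_eq_row_form:
  assumes "k \<ge> 1"
  shows "p_quad k = (\<Sum>d\<le>k. (- 1) ^ d * Var (Suc (k - d)) * row_form d k :: 'a::comm_ring_1 mpoly)"
proof -
  have row: "(\<Sum>j = k..2 * k - i. Const (lam k i j :: 'a) * Var (i + 1) * Var (j + 1))
      = (- 1) ^ (k - i) * Var (Suc i) * row_form (k - i) k" (is "?l = _") if "i \<le> k" for i
  proof -
    have "?l = (\<Sum>j = k..k + (k - i). Const (lam k i j :: 'a) * Var (i + 1) * Var (j + 1))"
      using that by (simp add: mult_2)
    also have "\<dots> = (\<Sum>e\<le>k - i. Const (lam k i (k + e) :: 'a) * Var (i + 1) * Var (k + e + 1))"
      by (simp add: sum.atLeastAtMost_shift_0 atLeast0AtMost)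
    also have "\<dots> = (- 1) ^ (k - i) * Var (Suc i) * row_form (k - i) k"
    proof -
      have "lam k i (k + e) = ((- 1) ^ (k - i) * of_nat (row_coeff (k - i) e) :: 'a)" for e
        using that by (simp add: lam_def row_coeff_def)
      then show ?thesis
        by (simp add: row_form_eq sum_distrib_left Const_mult Const_of_nat
            Const_minus_one_power mult_ac)
    qed
    finally show ?thesis .
  qed
  have last: "Var 1 * (\<Sum>i = k..2 * k. Const (mu k i :: 'a) * Var (i + 1))
      = - ((- 1) ^ k * Var (Suc 0) * row_form k k)"
  proof -
    \<comment> \<open>The \<mu>-sum is the missing row i = 0 of the \<lambda>-sum, up to the minus
      sign in front of x_1.\<close>
    have "lam k 0 j = (- mu k j :: 'a)" for j
      using assms by (cases k) (simp_all add: lam_def mu_def)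
    then have "Var 1 * (\<Sum>i = k..2 * k. Const (mu k i :: 'a) * Var (i + 1))
        = - (\<Sum>j = k..2 * k - 0. Const (lam k 0 j) * Var (0 + 1) * Var (j + 1))"
      by (simp add: Const_uminus sum_distrib_left sum_negf mult_ac)
    also have "\<dots> = - ((- 1) ^ k * Var (Suc 0) * row_form k k)"
      unfolding row[OF le0] by simp
    finally show ?thesis .
  qed
  have mid: "(\<Sum>i = 1..k - 1. \<Sum>j = k..2 * k - i. Const (lam k i j :: 'a) * Var (i + 1) * Var (j + 1))
      = (\<Sum>d = 1..k - 1. (- 1) ^ d * Var (Suc (k - d)) * row_form d k)"
  proof -
    have "(\<Sum>i = 1..k - 1. \<Sum>j = k..2 * k - i. Const (lam k i j :: 'a) * Var (i + 1) * Var (j + 1))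
        = (\<Sum>i = 1..k - 1. (- 1) ^ (k - i) * Var (Suc i) * row_form (k - i) k)"
      by (intro sum.cong refl row) auto
    also have "\<dots> = (\<Sum>d = 1..k - 1. (- 1) ^ d * Var (Suc (k - d)) * row_form d k)"
      by (rule sum.reindex_bij_witness[where i = "\<lambda>d. k - d" and j = "\<lambda>i. k - i"]) auto
    finally show ?thesis .
  qed
  have split: "{..k} = insert 0 (insert k {1..k - 1})"
    using assms by auto
  show ?thesis
    unfolding p_quad_def mid last split using assms
    by (simp add: power2_eq_square)
qed

lemma sigma_aut_p_quad:
  assumes "k \<ge> 1"
  shows "sigma_aut (p_quad k) = (p_quad k :: 'a::comm_ring_1 mpoly)"
proof -
  \<comment> \<open>\<open>w i\<close> is \<sigma>(y_i) - y_i, that is y_(i-1), with value 0 at i =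
    0 because x_1 is fixed.\<close>
  define w where "w i = (if i = 0 then 0 else Var i :: 'a mpoly)" for i
  have sigma_Var: "sigma_aut (Var (Suc i)) = Var (Suc i) + w i" for i
    by (simp add: sigma_aut_Var w_def)
  obtain l where k: "k = Suc l"
    using assms by (cases k) auto
  let ?P = "\<lambda>D. \<Sum>d\<le>D. (- 1) ^ d * Var (Suc (k - d)) * row_form d k"
  have sign: "sigma_aut ((- 1) ^ d) = ((- 1) ^ d :: 'a mpoly)" for d
    by (simp add: sigma_aut_power sigma_aut_uminus sigma_aut_1)
  \<comment> \<open>A partial sum is invariant up to one boundary term, which contains
    \<open>w 0 = 0\<close> once D + 1 = k. The induction starts with two summands because \<sigma>
    u_d(k) = u_(d+1)(k-1) fails for d = 0.\<close>
  have "sigma_aut (?P (Suc D)) = ?P (Suc D) + (- 1) ^ Suc D * w (k - Suc D) * row_form (Suc (Suc D)) l"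
    if "Suc D \<le> k" for D
    using that
  proof (induction D)
    case 0
    then show ?case
      by (simp add: k sigma_aut_add sigma_aut_diff sigma_aut_mult sigma_aut_row_form sigma_Var sigma_aut_2
          w_def[of "Suc _"])
        (simp add: algebra_simps)
  next
    case (Suc D)
    then have w: "w (k - Suc D) = Var (Suc (k - Suc (Suc D)))"
      by (simp add: w_def Suc_diff_Suc)
    have step: "sigma_aut (row_form (Suc (Suc D)) k :: 'a mpoly) = row_form (Suc (Suc (Suc D))) l"
      unfolding k sigma_aut_row_form by simp
    \<comment> \<open>The first part cancels the old boundary term, the second restores the summand
      before \<sigma> was applied.\<close>
    have split: "row_form (Suc (Suc (Suc D))) l
        = (row_form (Suc (Suc D)) l + row_form (Suc (Suc D)) k :: 'a mpoly)"
      by (simp add: k)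
    have "sigma_aut (?P (Suc (Suc D))) = sigma_aut (?P (Suc D))
        + sigma_aut ((- 1) ^ Suc (Suc D) * Var (Suc (k - Suc (Suc D))) * row_form (Suc (Suc D)) k)"
      by (simp only: sum.atMost_Suc[of _ "Suc D"] sigma_aut_add)
    also have "\<dots> = ?P (Suc D) + (- 1) ^ Suc D * w (k - Suc D) * row_form (Suc (Suc D)) l
        + (- 1) ^ Suc (Suc D) * (Var (Suc (k - Suc (Suc D))) + w (k - Suc (Suc D)))
          * row_form (Suc (Suc (Suc D))) l"
      using Suc by (simp only: sigma_aut_mult sign sigma_Var step)
    also have "\<dots> = ?P (Suc D) + (- 1) ^ Suc (Suc D) * Var (Suc (k - Suc (Suc D))) * row_form (Suc (Suc D)) k
        + (- 1) ^ Suc (Suc D) * w (k - Suc (Suc D)) * row_form (Suc (Suc (Suc D))) l"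
      unfolding w split by (simp only: power_Suc) (simp add: algebra_simps)
    finally show ?case
      by (simp only: sum.atMost_Suc[of _ "Suc D"])
  qed
  from this[of l] show ?thesis
    using assms by (simp add: p_quad_eq_row_form k w_def del: sum.atMost_Suc row_form.simps)
qed


subsection \<open>Quadratic forms and their matrices\<close>

abbreviation quad_monom :: "nat \<Rightarrow> nat \<Rightarrow> nat \<Rightarrow>\<^sub>0 nat" where
  "quad_monom i j \<equiv> Poly_Mapping.single i 1 + Poly_Mapping.single j 1"

lemma quad_monom_eq_iff:
  "quad_monom i j = quad_monom a b \<longleftrightarrow> i = a \<and> j = b \<or> i = b \<and> j = a"
proof
  assume "quad_monom i j = quad_monom a b"
  then have *: "Poly_Mapping.lookup (quad_monom i j) x = Poly_Mapping.lookup (quad_monom a b) x" for x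
    by simp
  show "i = a \<and> j = b \<or> i = b \<and> j = a"
    using *[of i] *[of j] *[of a] *[of b]
    by (auto simp: lookup_add lookup_single when_def split: if_splits)
qed (auto simp: add.commute)

lemma Const_Var_Var: "Const c * Var i * Var j = Poly_Mapping.single (quad_monom i j) (c :: 'a::comm_ring_1)"
  by (simp add: Const_def Var_def mult_single)

lemma monom_degree_superset:
  assumes "finite A" "Poly_Mapping.keys m \<subseteq> A"
  shows "monom_degree m = (\<Sum>i\<in>A. Poly_Mapping.lookup m i)"
  unfolding monom_degree_def
  by (rule sum.mono_neutral_left) (use assms in \<open>auto simp: in_keys_iff\<close>)

lemma monom_degree_add: "monom_degree (a + b) = monom_degree a + monom_degree b"
proof -
  have "finite (Poly_Mapping.keys a \<union> Poly_Mapping.keys b)"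
    by simp
  then show ?thesis
    using monom_degree_superset[of "Poly_Mapping.keys a \<union> Poly_Mapping.keys b"] keys_add[of a b]
    by (simp add: lookup_add sum.distrib)
qed

lemma monom_degree_single: "monom_degree (Poly_Mapping.single i c) = c"
  by (simp add: monom_degree_def)

lemma monom_degree_eq_0_iff: "monom_degree m = 0 \<longleftrightarrow> m = 0"
  by (auto simp: monom_degree_def in_keys_iff poly_mapping_eq_iff fun_eq_iff)

lemma monom_eq_single_add:
  assumes "monom_degree m = Suc d"
  obtains i m' where "m = Poly_Mapping.single i 1 + m'" "monom_degree m' = d"
proof -
  from assms have "m \<noteq> 0"
    by (auto simp: monom_degree_def)
  then obtain i where "i \<in> Poly_Mapping.keys m"
    by (metis all_not_in_conv keys_eq_empty)
  then have "m = Poly_Mapping.single i 1 + (m - Poly_Mapping.single i 1)"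
    by (intro poly_mapping_eqI)
      (auto simp: lookup_add lookup_minus lookup_single when_def in_keys_iff)
  with assms that show thesis
    by (metis monom_degree_add monom_degree_single add_left_cancel plus_1_eq_Suc)
qed

lemma monom_degree_2E:
  assumes "monom_degree m = 2"
  obtains i j where "m = quad_monom i j"
proof -
  obtain i m' where m: "m = Poly_Mapping.single i 1 + m'" "monom_degree m' = Suc 0"
    using monom_eq_single_add[of m "Suc 0"] assms by auto
  obtain j where "m' = Poly_Mapping.single j 1"
    using monom_eq_single_add[OF m(2)] monom_degree_eq_0_iff by (metis add.right_neutral)
  with m that show thesis
    by blast
qed

definition quad_form :: "nat \<Rightarrow> (nat \<Rightarrow> nat \<Rightarrow> 'a::comm_ring_1) \<Rightarrow> 'a mpoly" where
  "quad_form N B = (\<Sum>i = 1..N. \<Sum>j = 1..N. Const (B i j) * Var i * Var j)"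

definition quad_coeff :: "'a::zero mpoly \<Rightarrow> nat \<Rightarrow> nat \<Rightarrow> 'a" where
  "quad_coeff f i j = Poly_Mapping.lookup f (quad_monom i j)"

lemma quad_coeff_sum: "quad_coeff (sum F A) i j = (\<Sum>x\<in>A. quad_coeff (F x) i j)"
  by (simp add: quad_coeff_def lookup_sum)

lemma sum_sum_delta:
  assumes "finite S" "finite T" "a \<in> S" "b \<in> T"
  shows "(\<Sum>i\<in>S. \<Sum>j\<in>T. if i = a \<and> j = b then F i j else 0) = F a b"
proof -
  have "(\<Sum>j\<in>T. if i = a \<and> j = b then F i j else 0) = (if i = a then F i b else 0)" for i
    using assms by simp
  then show ?thesis
    using assms by simp
qed

lemma quad_coeff_quad_form:
  assumes "a \<in> {1..N}" "b \<in> {1..N}"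
  shows "quad_coeff (quad_form N B) a b = (if a = b then B a b else B a b + B b a)"
proof -
  have "quad_coeff (Const (B i j) * Var i * Var j) a b
      = (if i = a \<and> j = b then B i j else 0) + (if i = b \<and> j = a then if a = b then 0 else B i j else 0)"
    for i j
    unfolding quad_coeff_def Const_Var_Var lookup_single quad_monom_eq_iff
    by (cases "i = a"; cases "j = b"; cases "i = b"; cases "j = a") simp_all
  then have "quad_coeff (quad_form N B) a b
      = (\<Sum>i = 1..N. \<Sum>j = 1..N. (if i = a \<and> j = b then B i j else 0)
        + (if i = b \<and> j = a then if a = b then 0 else B i j else 0))"
    by (simp only: quad_form_def quad_coeff_sum)
  also have "\<dots> = B a b + (if a = b then 0 else B b a)"
    using assms by (simp only: sum.distrib sum_sum_delta finite_atLeastAtMost)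
  finally show ?thesis
    by simp
qed

text \<open>Each mixed coefficient is shared equally between (i, j) and (j, i), which characteristic
  zero permits; this gives the symmetric matrix of \<open>f\<close>.\<close>

lemma quad_form_quad_coeff:
  fixes f :: "'a::field_char_0 mpoly"
  assumes "f \<in> poly_alg N" "homogeneous 2 f"
  shows "f = quad_form N (\<lambda>i j. if i = j then quad_coeff f i j else quad_coeff f i j / 2)"
    (is "_ = quad_form N ?B")
proof (rule poly_mapping_eqI)
  fix m
  show "Poly_Mapping.lookup f m = Poly_Mapping.lookup (quad_form N ?B) m"
  proof (cases "\<exists>i\<in>{1..N}. \<exists>j\<in>{1..N}. m = quad_monom i j")
    case True
    then obtain i j where ij: "i \<in> {1..N}" "j \<in> {1..N}" and m: "m = quad_monom i j"
      by blast
    show ?thesis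
      using quad_coeff_quad_form[OF ij, of ?B] unfolding m
      by (auto simp: quad_coeff_def add.commute split: if_splits)
  next
    case False
    have "Poly_Mapping.lookup f m = 0"
    proof (rule ccontr)
      assume "Poly_Mapping.lookup f m \<noteq> 0"
      then have "m \<in> Poly_Mapping.keys f"
        by (simp add: in_keys_iff)
      with assms obtain i j where m: "m = quad_monom i j"
        unfolding homogeneous_def by (metis monom_degree_2E)
      have "i \<in> Poly_Mapping.keys m" "j \<in> Poly_Mapping.keys m"
        unfolding m in_keys_iff lookup_add by simp_all
      with \<open>m \<in> Poly_Mapping.keys f\<close> assms(1) False m show False
        unfolding poly_alg_def by blast
    qed
    moreover have "Poly_Mapping.lookup (quad_form N ?B) m = 0"
      unfolding quad_form_def Const_Var_Var lookup_sum lookup_single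
    proof (intro sum.neutral ballI)
      show "(?B i j when quad_monom i j = m) = 0" if "i \<in> {1..N}" "j \<in> {1..N}" for i j
      proof -
        have "quad_monom i j \<noteq> m"
          using False that by blast
        then show ?thesis by simp
      qed
    qed
    ultimately show ?thesis
      by simp
  qed
qed

text \<open>An index shift. The \<open>C i\<close> may be polynomials, so that it applies first to
  constant entries over j and then to the resulting linear forms over i.\<close>

lemma sum_mult_sigma_aut_Var:
  assumes "C (Suc N) = 0"
  shows "(\<Sum>i = 1..N. C i * sigma_aut (Var i)) = (\<Sum>i = 1..N. (C i + C (Suc i)) * Var i)"
proof -
  have "(\<Sum>i = 1..n. C i * sigma_aut (Var i)) + (if n = 0 then 0 else C (Suc n) * Var n)
      = (\<Sum>i = 1..n. (C i + C (Suc i)) * Var i)" for n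
    by (induction n) (auto simp: sigma_aut_Var algebra_simps)
  from this[of N] assms show ?thesis
    by (simp split: if_splits)
qed

lemma sigma_aut_quad_form:
  assumes "\<And>i. B i (Suc N) = 0" "\<And>j. B (Suc N) j = 0"
  shows "sigma_aut (quad_form N B)
    = quad_form N (\<lambda>i j. B i j + B (Suc i) j + B i (Suc j) + B (Suc i) (Suc j))"
proof -
  have inner: "(\<Sum>j = 1..N. Const (B i j) * sigma_aut (Var j))
      = (\<Sum>j = 1..N. (Const (B i j) + Const (B i (Suc j))) * Var j)" for i
    by (rule sum_mult_sigma_aut_Var) (simp add: assms Const_0)
  let ?C = "\<lambda>i. \<Sum>j = 1..N. (Const (B i j) + Const (B i (Suc j))) * Var j"
  have "sigma_aut (quad_form N B)
      = (\<Sum>i = 1..N. (\<Sum>j = 1..N. Const (B i j) * sigma_aut (Var j)) * sigma_aut (Var i))"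
    by (simp add: quad_form_def sigma_aut_sum sigma_aut_mult sigma_aut_Const sum_distrib_left
        sum_distrib_right mult_ac)
  also have "\<dots> = (\<Sum>i = 1..N. ?C i * sigma_aut (Var i))"
    by (simp only: inner)
  also have "\<dots> = (\<Sum>i = 1..N. (?C i + ?C (Suc i)) * Var i)"
    by (rule sum_mult_sigma_aut_Var) (simp add: assms Const_0)
  also have "\<dots> = quad_form N (\<lambda>i j. B i j + B (Suc i) j + B i (Suc j) + B (Suc i) (Suc j))"
    unfolding quad_form_def sum.distrib[symmetric] sum_distrib_right
    by (intro sum.cong refl) (simp add: Const_add algebra_simps)
  finally show ?thesis .
qed


subsection \<open>An invariant is determined by its first squares\<close>

lemma antidiagonal_recurrence_zero:
  fixes b :: "nat \<Rightarrow> nat \<Rightarrow> 'a::field_char_0"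
  assumes sym: "\<And>i j. b i j = b j i"
    and supp: "\<And>i j. n < j \<Longrightarrow> b i j = 0"
    and rec: "\<And>i j. b (Suc i) j + b i (Suc j) + b (Suc i) (Suc j) = 0"
    and diag: "\<And>i. i \<le> n div 2 \<Longrightarrow> b i i = 0"
  shows "b i j = 0"
proof -
  \<comment> \<open>Downward induction on i + j: \<open>t\<close> bounds the distance to the region
    i + j > 2n, where support and symmetry force zero.\<close>
  have "b i j = 0" if "2 * n < i + j + t" for t i j
    using that
  proof (induction t arbitrary: i j)
    case 0
    then have "n < i \<or> n < j"
      by linarith
    then show ?case
      using supp sym by metis
  next
    case (Suc t)
    define s where "s = i + j"
    have higher: "b i' j' = 0" if "s < i' + j'" for i' j'
      using Suc.IH[of i' j'] Suc.prems that by (simp add: s_def)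
    have alternate: "b i' j' = (- 1) ^ i' * b 0 s" if "i' + j' = s" for i' j'
      using that
    proof (induction i' arbitrary: j')
      case (Suc i')
      have "b (Suc i') j' + b i' (Suc j') = 0"
        using rec[of i' j'] higher[of "Suc i'" "Suc j'"] Suc.prems by simp
      then show ?case
        using Suc.IH[of "Suc j'"] Suc.prems by (simp add: eq_neg_iff_add_eq_0)
    qed simp
    have "b 0 s = 0"
    proof (cases "s \<le> n")
      case True
      show ?thesis
      proof (cases "even s")
        case True
        then obtain r where "s = r + r"
          by (auto elim!: evenE simp: mult_2)
        then show ?thesis
          using alternate[of r r] diag[of r] \<open>s \<le> n\<close> by simp
      next
        case False
        then show ?thesis
          using alternate[of s 0] sym[of 0 s] by simp
      qed
    qed (simp add: supp)
    then show ?case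
      using alternate[of i j] by (simp add: s_def)
  qed
  from this[of i j "Suc (2 * n)"] show ?thesis
    by simp
qed

lemma quadratic_invariant_eq_0:
  fixes f :: "'a::field_char_0 mpoly"
  assumes f: "f \<in> quadratic_invariants n"
    and squares: "\<And>k. k \<le> n div 2 \<Longrightarrow> quad_coeff f (Suc k) (Suc k) = 0"
  shows "f = 0"
proof -
  \<comment> \<open>Extension by zero supplies the border conditions for both the \<sigma>-formula
    and the recurrence.\<close>
  define B where "B i j = (if i \<in> {1..n + 1} \<and> j \<in> {1..n + 1}
    then if i = j then quad_coeff f i j else quad_coeff f i j / 2 else 0)" for i j
  have B_sym: "B i j = B j i" for i j
    by (auto simp: B_def quad_coeff_def add.commute)
  have B_supp: "B i j = 0" if "n + 1 < i \<or> n + 1 < j" for i j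
    using that by (auto simp: B_def)
  have f_eq: "f = quad_form (n + 1) B"
  proof -
    have "f = quad_form (n + 1) (\<lambda>i j. if i = j then quad_coeff f i j else quad_coeff f i j / 2)"
      using f by (intro quad_form_quad_coeff) (auto simp: quadratic_invariants_def)
    also have "\<dots> = quad_form (n + 1) B"
      unfolding quad_form_def by (intro sum.cong refl) (auto simp: B_def)
    finally show ?thesis .
  qed
  define S where "S i j = B i j + B (Suc i) j + B i (Suc j) + B (Suc i) (Suc j)" for i j
  have S_sym: "S i j = S j i" for i j
    unfolding S_def using B_sym[of i j] B_sym[of "Suc i" j] B_sym[of i "Suc j"]
      B_sym[of "Suc i" "Suc j"] by simp
  have "quad_form (n + 1) S = sigma_aut (quad_form (n + 1) B)"
    by (subst sigma_aut_quad_form) (auto simp: B_supp S_def[abs_def])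
  also have "\<dots> = quad_form (n + 1) B"
    using f unfolding f_eq[symmetric] quadratic_invariants_def by simp
  finally have coeff: "quad_coeff (quad_form (n + 1) S) i j = quad_coeff (quad_form (n + 1) B) i j" for i j
    by simp
  \<comment> \<open>Off the diagonal a form determines only the sum of two mirrored entries;
    symmetry of \<open>S\<close> and \<open>B\<close> turns this into equality of entries.\<close>
  have S_eq_B: "S i j = B i j" if "i \<in> {1..n + 1}" "j \<in> {1..n + 1}" for i j
    using coeff[of i j] S_sym[of i j] B_sym[of i j]
    unfolding quad_coeff_quad_form[OF that] by (auto split: if_splits)
  \<comment> \<open>Cancelling \<open>B i j\<close> in \<open>S i j = B i j\<close> leaves the
    recurrence; the shift by one passes from the x_i to the y_i.\<close>
  have "B (Suc i) (Suc j) = 0" for i j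
  proof (rule antidiagonal_recurrence_zero[where n = n and b = "\<lambda>i j. B (Suc i) (Suc j)"])
    show "B (Suc (Suc i)) (Suc j) + B (Suc i) (Suc (Suc j)) + B (Suc (Suc i)) (Suc (Suc j)) = 0"
      for i j
    proof (cases "i \<le> n \<and> j \<le> n")
      case True
      then show ?thesis
        using S_eq_B[of "Suc i" "Suc j"] by (simp add: S_def add.assoc)
    qed (auto simp: B_supp)
    show "B (Suc i) (Suc i) = 0" if "i \<le> n div 2" for i
      using squares[OF that] by (simp add: B_def)
  qed (auto intro: B_sym B_supp)
  then have "B i j = 0" if "i \<in> {1..n + 1}" "j \<in> {1..n + 1}" for i j
    using that by (cases i; cases j) auto
  then show ?thesis
    unfolding f_eq quad_form_def by (intro sum.neutral ballI) (simp add: Const_0)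
qed


subsection \<open>The basis\<close>

lemma homogeneous_add: "homogeneous d f \<Longrightarrow> homogeneous d g \<Longrightarrow> homogeneous d (f + g)"
  unfolding homogeneous_def using keys_add[of f g] by blast

lemma homogeneous_sum: "(\<And>x. x \<in> A \<Longrightarrow> homogeneous d (F x)) \<Longrightarrow> homogeneous d (sum F A)"
  by (induction A rule: infinite_finite_induct) (simp_all add: homogeneous_add, simp_all add: homogeneous_def)

lemma homogeneous_mult:
  fixes f g :: "'a::comm_ring_1 mpoly"
  assumes "homogeneous d f" "homogeneous e g"
  shows "homogeneous (d + e) (f * g)"
  unfolding homogeneous_def
proof
  fix m
  assume "m \<in> Poly_Mapping.keys (f * g)"
  then obtain a b where "m = a + b" "a \<in> Poly_Mapping.keys f" "b \<in> Poly_Mapping.keys g"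
    using subsetD[OF keys_mult] by blast
  then show "monom_degree m = d + e"
    using assms by (simp add: homogeneous_def monom_degree_add)
qed

lemma homogeneous_Const: "homogeneous 0 (Const c)"
  by (simp add: homogeneous_def Const_def monom_degree_eq_0_iff)

lemma homogeneous_Var: "homogeneous 1 (Var i)"
  by (simp add: homogeneous_def Var_def monom_degree_single)

lemma homogeneous_quad: "homogeneous 2 (Const c * Var i * Var j)" for c :: "'a::comm_ring_1"
  using homogeneous_mult[OF homogeneous_mult[OF homogeneous_Const homogeneous_Var] homogeneous_Var]
  by (simp add: numeral_2_eq_2)

lemma p_quad_eq_monomials:
  "p_quad k = Const 1 * Var (k + 1) * Var (k + 1)
     + (\<Sum>i = 1..k - 1. \<Sum>j = k..2 * k - i. Const (lam k i j) * Var (i + 1) * Var (j + 1))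
     + (\<Sum>i = k..2 * k. Const (- mu k i) * Var 1 * Var (i + 1))"
  by (simp add: p_quad_def power2_eq_square Const_1 Const_uminus sum_negf sum_distrib_left mult_ac)

text \<open>The largest variable index in p_k is 2k + 1, so the bound on \<open>k\<close> keeps p_k
  inside P_(n+1).\<close>

lemma p_quad_in_quadratic_invariants:
  assumes "1 \<le> k" "k \<le> n div 2"
  shows "p_quad k \<in> quadratic_invariants n"
proof -
  have "homogeneous 2 (p_quad k)"
    unfolding p_quad_eq_monomials by (intro homogeneous_add homogeneous_sum homogeneous_quad)
  moreover have "p_quad k \<in> poly_alg (n + 1)"
    unfolding p_quad_eq_monomials
    by (intro poly_alg_add poly_alg_sum poly_alg_mult poly_alg_Const poly_alg_Var)
      (use assms in auto)
  ultimately show ?thesis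
    using assms by (simp add: quadratic_invariants_def sigma_aut_p_quad)
qed

lemma Var_1_square_in_quadratic_invariants: "Var 1 ^ 2 \<in> quadratic_invariants n"
proof -
  have "homogeneous 2 (Var 1 ^ 2 :: 'a mpoly)"
    using homogeneous_quad[of 1 1 1] by (simp add: Const_1 power2_eq_square)
  then show ?thesis
    by (simp add: quadratic_invariants_def sigma_aut_power sigma_aut_Var poly_alg_power poly_alg_Var)
qed

lemma quad_coeff_add: "quad_coeff (f + g) i j = quad_coeff f i j + quad_coeff g i j"
  by (simp add: quad_coeff_def lookup_add)

lemma quad_coeff_diff: "quad_coeff (f - g) i j = quad_coeff f i j - quad_coeff g i j"
  for f g :: "'a::comm_ring_1 mpoly"
  by (simp add: quad_coeff_def lookup_minus)

lemma quad_coeff_scale: "quad_coeff (scale c f) i j = c * quad_coeff f i j"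
proof -
  have "scale c f = (\<Sum>m\<in>Poly_Mapping.keys f. Poly_Mapping.single m (c * Poly_Mapping.lookup f m))"
    unfolding scale_def
    by (subst (1) sum_monomials[of f]) (simp add: sum_distrib_left Const_def mult_single)
  then show ?thesis
    by (simp add: quad_coeff_def lookup_sum lookup_single when_def in_keys_iff)
qed

lemma quad_coeff_monomial:
  "quad_coeff (Const c * Var i * Var j) a a = (if i = a \<and> j = a then c else 0)"
  for c :: "'a::comm_ring_1"
  by (auto simp: quad_coeff_def Const_Var_Var lookup_single quad_monom_eq_iff when_def
      simp del: One_nat_def)

text \<open>The \<lambda>-sum has i < k \<le> j and the \<mu>-sum pairs x_1 with x_(i+1), i \<ge> 1,
  so neither contains a square.\<close>

lemma quad_coeff_p_quad:
  assumes "1 \<le> k"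
  shows "quad_coeff (p_quad k) (Suc l) (Suc l) = (if k = l then 1 else 0 :: 'a::comm_ring_1)"
proof -
  have "(\<Sum>i = 1..k - 1. \<Sum>j = k..2 * k - i.
      if i + 1 = Suc l \<and> j + 1 = Suc l then lam k i j else 0) = (0 :: 'a)"
    by (intro sum.neutral ballI) auto
  moreover have "(\<Sum>i = k..2 * k. if 1 = Suc l \<and> i + 1 = Suc l then - mu k i else 0) = (0 :: 'a)"
    by (intro sum.neutral ballI) (use assms in auto)
  ultimately show ?thesis
    unfolding p_quad_eq_monomials quad_coeff_add quad_coeff_sum quad_coeff_monomial by simp
qed

lemma subspace_quadratic_invariants:
  "mpoly.subspace (quadratic_invariants n :: 'a::field mpoly set)"
proof (rule mpoly.subspaceI)
  show "(0 :: 'a mpoly) \<in> quadratic_invariants n"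
    by (simp add: quadratic_invariants_def poly_alg_0 homogeneous_def sigma_aut_def subst_0)
next
  fix f g :: "'a mpoly"
  assume "f \<in> quadratic_invariants n" "g \<in> quadratic_invariants n"
  then show "f + g \<in> quadratic_invariants n"
    by (simp add: quadratic_invariants_def poly_alg_add homogeneous_add sigma_aut_add)
next
  fix c :: 'a and f :: "'a mpoly"
  assume "f \<in> quadratic_invariants n"
  moreover from this have "homogeneous (0 + 2) (scale c f)"
    unfolding scale_def quadratic_invariants_def by (intro homogeneous_mult homogeneous_Const) simp
  ultimately show "scale c f \<in> quadratic_invariants n"
    by (simp only: quadratic_invariants_def mem_Collect_eq sigma_aut_scale add_0)
      (simp add: scale_def poly_alg_mult poly_alg_Const)
qed

theorem corollary1p6:
  fixes n :: nat and q :: "nat \<Rightarrow> 'a::field_char_0 mpoly"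
  assumes "n \<ge> 2"
  defines "m \<equiv> n div 2"
  defines "q \<equiv> (\<lambda>k. if k = 0 then Var 1 ^ 2 else p_quad k)"
  shows "inj_on q {0..m} \<and>
         mpoly.independent (q ` {0..m}) \<and>
         mpoly.span (q ` {0..m}) = quadratic_invariants n"
proof (intro conjI)
  \<comment> \<open>The coefficients of the first m + 1 squares are functionals dual to
    \<open>q\<close>; injectivity, independence and the coordinates of an invariant all come from
    this.\<close>
  have dual: "quad_coeff (q k) (Suc l) (Suc l) = (if k = l then 1 else 0)" for k l
    using quad_coeff_monomial[of "1::'a" 1 1 "Suc l"]
    by (auto simp: q_def quad_coeff_p_quad Const_1 power2_eq_square)
  show inj: "inj_on q {0..m}"
    using dual by (metis inj_onI zero_neq_one)
  show "mpoly.independent (q ` {0..m})"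
  proof (rule mpoly.independent_if_scalars_zero)
    fix c x
    assume zero: "(\<Sum>x\<in>q ` {0..m}. scale (c x) x) = 0" and "x \<in> q ` {0..m}"
    then obtain l where l: "l \<in> {0..m}" "x = q l"
      by blast
    have "0 = (\<Sum>k = 0..m. quad_coeff (scale (c (q k)) (q k)) (Suc l) (Suc l))"
      using arg_cong[OF zero, of "\<lambda>f. quad_coeff f (Suc l) (Suc l)"]
      unfolding sum.reindex[OF inj] quad_coeff_sum by (simp add: quad_coeff_def)
    also have "\<dots> = c x"
      using l by (simp add: quad_coeff_scale dual if_distrib cong: if_cong)
    finally show "c x = 0" by simp
  qed simp
  have q_inv: "q k \<in> quadratic_invariants n" if "k \<le> m" for k
    using that Var_1_square_in_quadratic_invariants p_quad_in_quadratic_invariants[of k n]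
    by (auto simp: q_def m_def)
  show "mpoly.span (q ` {0..m}) = quadratic_invariants n"
  proof (rule antisym)
    show "mpoly.span (q ` {0..m}) \<subseteq> quadratic_invariants n"
      by (rule mpoly.span_minimal) (auto simp: q_inv subspace_quadratic_invariants)
    show "quadratic_invariants n \<subseteq> mpoly.span (q ` {0..m})"
    proof
      fix f :: "'a mpoly"
      assume f: "f \<in> quadratic_invariants n"
      \<comment> \<open>\<open>g\<close> has the same first m + 1 squares as \<open>f\<close>, so
        \<open>f - g\<close> is an invariant without them and vanishes.\<close>
      define g where "g = (\<Sum>k = 0..m. scale (quad_coeff f (Suc k) (Suc k)) (q k))"
      have "g \<in> quadratic_invariants n"
        unfolding g_def
        by (intro mpoly.subspace_sum mpoly.subspace_scale subspace_quadratic_invariants q_inv) simp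
      then have "f - g \<in> quadratic_invariants n"
        by (intro mpoly.subspace_diff subspace_quadratic_invariants f)
      moreover have "quad_coeff (f - g) (Suc l) (Suc l) = 0" if "l \<le> n div 2" for l
        using that
        by (simp add: g_def m_def quad_coeff_diff quad_coeff_sum quad_coeff_scale dual if_distrib cong: if_cong)
      ultimately have "f - g = 0"
        by (rule quadratic_invariant_eq_0)
      moreover have "g \<in> mpoly.span (q ` {0..m})"
        unfolding g_def by (intro mpoly.span_sum mpoly.span_scale mpoly.span_base imageI)
      ultimately show "f \<in> mpoly.span (q ` {0..m})"
        by simp
    qed
  qed
qed

end
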